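(* Let $n,m,p,T$ be positive integers with $m\ge p$, let $A_{\rm m}\in\mathbb{R}^{n\times n}$ be Schur and let $B_{\rm m}\in\mathbb{R}^{n\times p}$. Let $(U_-,X)$ be data generated by the noiseless system $x(t+1)=A_{\rm s}x(t)+B_{\rm s}u(t)$, where $A_{\rm s}\in\mathbb{R}^{n\times n}$ and $B_{\rm s}\in\mathbb{R}^{n\times m}$, with associated matrices $X_-,X_+\in\mathbb{R}^{n\times T}$ and $U_-\in\mathbb{R}^{m\times T}$. Then the data $(U_-,X)$ are informative for model reference control (MRC) if and only if there exist $V_1\in\mathbb{R}^{T\times n}$ and $V_2\in\mathbb{R}^{T\times p}$ such that $$X_-V_1=I,\qquad X_+V_1=A_{\rm m},\qquad X_-V_2=0,\qquad X_+V_2=B_{\rm m}.$$ Moreover, if $V_1$ and $V_2$ satisfy these equations, then the gains $K=U_-V_1$ and $L=U_-V_2$ are such that $\Sigma_{(U_-,X)}\subseteq\Sigma^{K,L}_{\rm exact}$.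
   Context: A square real matrix is Schur if all its eigenvalues have modulus strictly less than $1$. Data: $X=[x(0)\ x(1)\ \cdots\ x(T)]\in\mathbb{R}^{n\times(T+1)}$, $U_-=[u(0)\ \cdots\ u(T-1)]\in\mathbb{R}^{m\times T}$, $X_+=[x(1)\ \cdots\ x(T)]$, $X_-=[x(0)\ \cdots\ x(T-1)]$. The data being generated by the noiseless system means $X_+=A_{\rm s}X_-+B_{\rm s}U_-$. No further assumption is made on the data. The set of systems compatible with the data is $$\Sigma_{(U_-,X)}=\{(A,B)\in\mathbb{R}^{n\times n}\times\mathbb{R}^{n\times m}\mid X_+=AX_-+BU_-\}.$$ For gains $K\in\mathbb{R}^{m\times n}$, $L\in\mathbb{R}^{m\times p}$, the set of systems matching the reference model $x_{\rm m}(t+1)=A_{\rm m}x_{\rm m}(t)+B_{\rm m}r(t)$ under $u=Kx+Lr$ is $$\Sigma^{K,L}_{\rm exact}=\{(A,B)\in\mathbb{R}^{n\times n}\times\mathbb{R}^{n\times m}\mid A+BK=A_{\rm m},\ BL=B_{\rm m}\}.$$ The data $(U_-,X)$ are called informative for MRC if there exist $K\in\mathbb{R}^{m\times n}$ and $L\in\mathbb{R}^{m\times p}$ such that $\Sigma_{(U_-,X)}\subseteq\Sigma^{K,L}_{\rm exact}$. *)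

theory Defs
  imports "Jordan_Normal_Form.Char_Poly"
begin

(* The eigenvalues of a real matrix are its complex eigenvalues. *)
definition schur_stable :: "real mat \<Rightarrow> bool" where
  "schur_stable A \<longleftrightarrow> square_mat A \<and>
     (\<forall>k. eigenvalue (map_mat complex_of_real A) k \<longrightarrow> cmod k < 1)"

(* For a state data matrix X = [x(0) x(1) ... x(T)], X_minus X = [x(0) ... x(T-1)]
   and X_plus X = [x(1) ... x(T)]. *)
definition X_minus :: "real mat \<Rightarrow> real mat" where
  "X_minus X = mat (dim_row X) (dim_col X - 1) (\<lambda>(i, j). X $$ (i, j))"

definition X_plus :: "real mat \<Rightarrow> real mat" where
  "X_plus X = mat (dim_row X) (dim_col X - 1) (\<lambda>(i, j). X $$ (i, j + 1))"

(* n is the state dimension and m the input dimension. *)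
definition compatible_systems ::
  "nat \<Rightarrow> nat \<Rightarrow> real mat \<Rightarrow> real mat \<Rightarrow> (real mat \<times> real mat) set" where
  "compatible_systems n m U X =
     {(A, B). A \<in> carrier_mat n n \<and> B \<in> carrier_mat n m \<and>
        X_plus X = A * X_minus X + B * U}"

definition matching_systems ::
  "nat \<Rightarrow> nat \<Rightarrow> real mat \<Rightarrow> real mat \<Rightarrow> real mat \<Rightarrow> real mat \<Rightarrow> (real mat \<times> real mat) set" where
  "matching_systems n m Am Bm K L =
     {(A, B). A \<in> carrier_mat n n \<and> B \<in> carrier_mat n m \<and>
        A + B * K = Am \<and> B * L = Bm}"

(* p is the dimension of the reference input. *)
definition informative_MRC ::
  "nat \<Rightarrow> nat \<Rightarrow> nat \<Rightarrow> real mat \<Rightarrow> real mat \<Rightarrow> real mat \<Rightarrow> real mat \<Rightarrow> bool" where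
  "informative_MRC n m p Am Bm U X \<longleftrightarrow>
     (\<exists>K \<in> carrier_mat m n. \<exists>L \<in> carrier_mat m p.
        compatible_systems n m U X \<subseteq> matching_systems n m Am Bm K L)"

end

theory Submission imports Defs begin

text \<open>Differences of compatible systems are exactly the pairs \<open>(A, B)\<close> with
  \<open>A X\<^sub>- + B U = 0\<close>, so informativity forces \<open>A + B K = 0\<close> and \<open>B L = 0\<close> for all such pairs: the
  left kernel of the stacked data matrix \<open>[X\<^sub>-; U]\<close> annihilates the columns of \<open>[I; K]\<close> and
  \<open>[0; L]\<close>. By the Fredholm alternative these columns lie in the column space of \<open>[X\<^sub>-; U]\<close>, which
  yields \<open>V\<^sub>1\<close> and \<open>V\<^sub>2\<close>; applying the true system to them gives the equations for \<open>X\<^sub>+\<close>.\<close>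

text \<open>Vector form of the Fredholm alternative, by elimination: subtracting a suitable multiple
  of \<open>v T\<close> from \<open>b\<close> leaves a vector to which the induction hypothesis
  applies. Membership in the span is phrased through the functionals \<open>y \<bullet> _\<close>,
  so only scalar sums have to be handled.\<close>

lemma scalar_prod_in_span_if_common_kernel:
  fixes v :: "nat \<Rightarrow> 'a :: field vec"
  assumes "\<And>i. i < T \<Longrightarrow> v i \<in> carrier_vec q" and "b \<in> carrier_vec q"
    and "\<And>y. y \<in> carrier_vec q \<Longrightarrow> (\<And>i. i < T \<Longrightarrow> y \<bullet> v i = 0) \<Longrightarrow> y \<bullet> b = 0"
  shows "\<exists>c. \<forall>y \<in> carrier_vec q. y \<bullet> b = (\<Sum>i<T. c i * (y \<bullet> v i))"
  using assms
proof (induction T arbitrary: b)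
  case 0
  then show ?case by auto
next
  case (Suc T)
  note v = Suc.prems(1) and b = Suc.prems(2) and ker = Suc.prems(3)
  have vT: "v T \<in> carrier_vec q" using v by simp
  show ?case
  proof (cases "\<forall>y \<in> carrier_vec q. (\<forall>i<T. y \<bullet> v i = 0) \<longrightarrow> y \<bullet> v T = 0")
    \<comment> \<open>Here \<open>v T\<close> imposes no constraint beyond those of the earlier
      vectors, so it gets coefficient 0.\<close>
    case True
    then have "\<And>y. y \<in> carrier_vec q \<Longrightarrow> (\<And>i. i < T \<Longrightarrow> y \<bullet> v i = 0) \<Longrightarrow> y \<bullet> b = 0"
      using ker by (auto simp: less_Suc_eq)
    then obtain c where c: "\<forall>y \<in> carrier_vec q. y \<bullet> b = (\<Sum>i<T. c i * (y \<bullet> v i))"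
      using Suc.IH[OF _ b] v by (force simp: less_Suc_eq)
    have "\<forall>y \<in> carrier_vec q. y \<bullet> b = (\<Sum>i<Suc T. (c(T := 0)) i * (y \<bullet> v i))"
      using c by simp
    then show ?thesis by blast
  next
    case False
    then obtain y0 where y0: "y0 \<in> carrier_vec q" and y0_ker: "\<And>i. i < T \<Longrightarrow> y0 \<bullet> v i = 0"
      and y0_T: "y0 \<bullet> v T \<noteq> 0" by blast
    \<comment> \<open>Pairing the desired identity with \<open>y0\<close> kills every term but the
      last, so this is the only possible coefficient of \<open>v T\<close>. It makes
      \<open>y0 \<bullet> b' = 0\<close>.\<close>
    define k where "k = (y0 \<bullet> b) / (y0 \<bullet> v T)"
    define b' where "b' = b - k \<cdot>\<^sub>v v T"
    have b': "b' \<in> carrier_vec q" using b vT by (simp add: b'_def)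
    have prod_b': "y \<bullet> b' = y \<bullet> b - k * (y \<bullet> v T)" if "y \<in> carrier_vec q" for y
      using that b vT unfolding b'_def by (simp add: scalar_prod_minus_distrib[of _ q])
    have "y \<bullet> b' = 0" if y: "y \<in> carrier_vec q" and y_ker: "\<And>i. i < T \<Longrightarrow> y \<bullet> v i = 0" for y
    proof -
      \<comment> \<open>Correcting \<open>y\<close> by this multiple of \<open>y0\<close> makes it
        annihilate \<open>v T\<close> as well, without disturbing the earlier products. By the
        choice of \<open>k\<close>, \<open>z \<bullet> b\<close> equals
        \<open>y \<bullet> b'\<close>.\<close>
      define l where "l = (y \<bullet> v T) / (y0 \<bullet> v T)"
      define z where "z = y - l \<cdot>\<^sub>v y0"
      have z: "z \<in> carrier_vec q" using y y0 by (simp add: z_def)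
      have prod_z: "z \<bullet> w = y \<bullet> w - l * (y0 \<bullet> w)" if "w \<in> carrier_vec q" for w
        using that y y0 unfolding z_def by (simp add: minus_scalar_prod_distrib[of _ q])
      have "z \<bullet> v i = 0" if "i < Suc T" for i
        using that prod_z[OF v[OF that]] y_ker y0_ker y0_T by (cases "i = T") (auto simp: l_def)
      then have "z \<bullet> b = 0" using ker z by blast
      then show ?thesis
        using prod_z[OF b] prod_b'[OF y] by (simp add: k_def l_def)
    qed
    then obtain c where c: "\<forall>y \<in> carrier_vec q. y \<bullet> b' = (\<Sum>i<T. c i * (y \<bullet> v i))"
      using Suc.IH[OF _ b'] v by (force simp: less_Suc_eq)
    have "y \<bullet> b = (\<Sum>i<Suc T. (c(T := k)) i * (y \<bullet> v i))" if "y \<in> carrier_vec q" for y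
      using c prod_b'[OF that] that by (simp add: diff_eq_eq)
    then show ?thesis by blast
  qed
qed

text \<open>The vector form is applied to each column of \<open>N\<close> separately; the
  coefficients found for column \<open>j\<close> become column \<open>j\<close> of
  \<open>V\<close>.\<close>

lemma mult_mat_solvable_if_left_kernel:
  fixes M N :: "'a :: field mat"
  assumes M: "M \<in> carrier_mat q T" and N: "N \<in> carrier_mat q r"
    and ker: "\<And>y j. y \<in> carrier_vec q \<Longrightarrow> (\<And>i. i < T \<Longrightarrow> y \<bullet> col M i = 0) \<Longrightarrow> j < r \<Longrightarrow>
      y \<bullet> col N j = 0"
  shows "\<exists>V \<in> carrier_mat T r. M * V = N"
proof -
  have "\<exists>c. \<forall>y \<in> carrier_vec q. y \<bullet> col N j = (\<Sum>i<T. c i * (y \<bullet> col M i))" if "j < r" for j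
    by (rule scalar_prod_in_span_if_common_kernel) (use M N ker that in auto)
  then obtain c where c: "\<And>j y. j < r \<Longrightarrow> y \<in> carrier_vec q \<Longrightarrow>
      y \<bullet> col N j = (\<Sum>i<T. c j i * (y \<bullet> col M i))"
    by metis
  define V where "V = mat T r (\<lambda>(i, j). c j i)"
  have "M * V = N"
  proof (rule eq_matI)
    fix i j assume "i < dim_row N" "j < dim_col N"
    then have i: "i < q" and j: "j < r" using N by auto
    \<comment> \<open>Testing the identity of functionals on unit vectors recovers the matrix
      entries.\<close>
    have "N $$ (i, j) = unit_vec q i \<bullet> col N j"
      using i j N by (simp add: scalar_prod_left_unit[of _ q])
    also have "\<dots> = (\<Sum>k<T. c j k * M $$ (i, k))"
      using c[OF j, of "unit_vec q i"] M i
      by (simp add: scalar_prod_left_unit[of _ q])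
    also have "\<dots> = (M * V) $$ (i, j)"
      using i j M by (simp add: V_def scalar_prod_def atLeast0LessThan mult.commute)
    finally show "(M * V) $$ (i, j) = N $$ (i, j)" by simp
  qed (use M N in \<open>auto simp: V_def\<close>)
  then show ?thesis by (intro bexI[of _ V]) (auto simp: V_def)
qed

text \<open>Adapts the alternative to the pairs supplied by informativity: the kernel condition
  concerns matrices with \<open>k\<close> rows instead of single row vectors. Since \<open>k\<close>
  is positive, a row vector can be turned into such a matrix and read back from it.\<close>

lemma stacked_mult_mat_solvable_if_left_kernel:
  fixes X U P Q :: "'a :: field mat"
  assumes k: "0 < k"
    and X: "X \<in> carrier_mat n T" and U: "U \<in> carrier_mat m T"
    and P: "P \<in> carrier_mat n r" and Q: "Q \<in> carrier_mat m r"
    and ker: "\<And>A B. A \<in> carrier_mat k n \<Longrightarrow> B \<in> carrier_mat k m \<Longrightarrow>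
      A * X + B * U = 0\<^sub>m k T \<Longrightarrow> A * P + B * Q = 0\<^sub>m k r"
  shows "\<exists>V \<in> carrier_mat T r. X * V = P \<and> U * V = Q"
proof -
  have col_append: "col (C @\<^sub>r D) j = col C j @\<^sub>v col D j"
    if "C \<in> carrier_mat n s" "D \<in> carrier_mat m s" "j < s" for C D :: "'a mat" and s j
    unfolding append_rows_def using that by (intro eq_vecI) auto
  have "\<exists>V \<in> carrier_mat T r. (X @\<^sub>r U) * V = P @\<^sub>r Q"
  proof (rule mult_mat_solvable_if_left_kernel)
    fix y j
    assume y: "y \<in> carrier_vec (n + m)" and j: "j < r"
      and y_ker: "\<And>i. i < T \<Longrightarrow> y \<bullet> col (X @\<^sub>r U) i = 0"
    obtain a b where a: "a \<in> carrier_vec n" and b: "b \<in> carrier_vec m" and ab: "y = a @\<^sub>v b"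
      by (rule that[OF vec_first_carrier vec_last_carrier vec_first_last_append[OF y, symmetric]])
    \<comment> \<open>All \<open>k\<close> rows of \<open>A\<close> are \<open>a\<close> and all
      rows of \<open>B\<close> are \<open>b\<close>, so every entry of \<open>A * C + B * D\<close>
      is the product of \<open>y\<close> with a column of the stacked matrix.\<close>
    define A where "A = mat k n (\<lambda>(i, j). a $ j)"
    define B where "B = mat k m (\<lambda>(i, j). b $ j)"
    have A: "A \<in> carrier_mat k n" and B: "B \<in> carrier_mat k m" by (auto simp: A_def B_def)
    have rows: "row A i = a" "row B i = b" if "i < k" for i
      using that a b by (auto simp: A_def B_def)
    have entry: "(A * C + B * D) $$ (i, j) = y \<bullet> col (C @\<^sub>r D) j"
      if "C \<in> carrier_mat n s" "D \<in> carrier_mat m s" "i < k" "j < s" for C D s i j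
      using that A B a b rows by (simp add: ab col_append scalar_prod_append[of _ n _ m])
    have "A * X + B * U = 0\<^sub>m k T"
    proof (rule eq_matI)
      fix i j assume "i < dim_row (0\<^sub>m k T :: 'a mat)" "j < dim_col (0\<^sub>m k T :: 'a mat)"
      then have i: "i < k" and j: "j < T" by simp_all
      show "(A * X + B * U) $$ (i, j) = 0\<^sub>m k T $$ (i, j)"
        unfolding entry[OF X U i j] y_ker[OF j] using i j by simp
    qed (use B U in simp_all)
    then have "A * P + B * Q = 0\<^sub>m k r" by (rule ker[OF A B])
    \<comment> \<open>Row 0 gives the claim back.\<close>
    then show "y \<bullet> col (P @\<^sub>r Q) j = 0"
      unfolding entry[OF P Q k j, symmetric] using j k by simp
  qed (rule carrier_append_rows[OF X U], rule carrier_append_rows[OF P Q])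
  then obtain V where V: "V \<in> carrier_mat T r" and eq: "(X @\<^sub>r U) * V = P @\<^sub>r Q" by blast
  have col_eq: "col (X * V) j = col P j \<and> col (U * V) j = col Q j" if j: "j < r" for j
  proof -
    have "(X *\<^sub>v col V j) @\<^sub>v (U *\<^sub>v col V j) = (X @\<^sub>r U) *\<^sub>v col V j"
      by (rule mat_mult_append[OF X U, symmetric]) (rule col_carrier_vec[OF j V])
    also have "\<dots> = col (P @\<^sub>r Q) j"
      unfolding eq[symmetric] by (rule col_mult2[OF carrier_append_rows[OF X U] V j, symmetric])
    also have "\<dots> = col P j @\<^sub>v col Q j" by (rule col_append[OF P Q j])
    finally have "X *\<^sub>v col V j = col P j \<and> U *\<^sub>v col V j = col Q j"
      unfolding append_vec_eq[OF mult_mat_vec_carrier[OF X col_carrier_vec[OF j V]]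
          col_carrier_vec[OF j P]] .
    then show ?thesis unfolding col_mult2[OF X V j] col_mult2[OF U V j] .
  qed
  have "X * V = P"
    by (rule mat_col_eqI) (use col_eq X V P in simp_all)
  moreover have "U * V = Q"
    by (rule mat_col_eqI) (use col_eq U V Q in simp_all)
  ultimately show ?thesis using V by blast
qed

lemma X_minus_carrier: "X \<in> carrier_mat n (T + 1) \<Longrightarrow> X_minus X \<in> carrier_mat n T"
  by (auto simp: X_minus_def)

lemma X_plus_mult:
  assumes "A \<in> carrier_mat n n" "B \<in> carrier_mat n m"
    and "X \<in> carrier_mat n (T + 1)" "U \<in> carrier_mat m T" "V \<in> carrier_mat T r"
    and "X_plus X = A * X_minus X + B * U"
  shows "X_plus X * V = A * (X_minus X * V) + B * (U * V)"
  using assms X_minus_carrier[of X n T]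
  by (simp add: add_mult_distrib_mat[of _ n T] assoc_mult_mat[of _ n n _ T]
      assoc_mult_mat[of _ n m _ T])

text \<open>Adding \<open>(A, B)\<close> to the true system gives another compatible system. Both
  match the same reference model with the same gains, so subtracting the matching equations leaves
  only \<open>A\<close> and \<open>B\<close>.\<close>

lemma informative_MRC_imp_left_kernel:
  assumes compat: "(As, Bs) \<in> compatible_systems n m U X"
    and sub: "compatible_systems n m U X \<subseteq> matching_systems n m Am Bm K L"
    and X: "X \<in> carrier_mat n (T + 1)" and U: "U \<in> carrier_mat m T"
    and K: "K \<in> carrier_mat m n" and L: "L \<in> carrier_mat m p"
    and A: "A \<in> carrier_mat n n" and B: "B \<in> carrier_mat n m"
    and ker: "A * X_minus X + B * U = 0\<^sub>m n T"
  shows "A + B * K = 0\<^sub>m n n" and "B * L = 0\<^sub>m n p"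
proof -
  note Xm = X_minus_carrier[OF X]
  have As: "As \<in> carrier_mat n n" and Bs: "Bs \<in> carrier_mat n m"
    and sys: "X_plus X = As * X_minus X + Bs * U"
    using compat by (auto simp: compatible_systems_def)
  \<comment> \<open>Needed for two pairs \<open>(C, D)\<close>: the data
    \<open>(X_minus X, U)\<close> for compatibility, and \<open>(I, K)\<close> for matching.\<close>
  have dist: "(As + A) * C + (Bs + B) * D = (As * C + Bs * D) + (A * C + B * D)"
    if "C \<in> carrier_mat n r" "D \<in> carrier_mat m r" for C D r
    using that As Bs A B
    by (simp add: add_mult_distrib_mat[of _ n n] add_mult_distrib_mat[of _ n m])
      (auto intro!: eq_matI)
  have cancel: "D = 0\<^sub>m n r" if "C + D = C" "C \<in> carrier_mat n r" "D \<in> carrier_mat n r"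
    for C D :: "real mat" and r
  proof (rule eq_matI)
    fix i j assume ij: "i < dim_row (0\<^sub>m n r :: real mat)" "j < dim_col (0\<^sub>m n r :: real mat)"
    have "C $$ (i, j) + D $$ (i, j) = (C + D) $$ (i, j)" using ij that(3) by simp
    also have "\<dots> = C $$ (i, j)" unfolding that(1) ..
    finally show "D $$ (i, j) = 0\<^sub>m n r $$ (i, j)" using ij by simp
  qed (use that in auto)
  have "(As + A, Bs + B) \<in> compatible_systems n m U X"
    using As Bs A B U Xm dist[OF Xm U] ker sys
    by (auto simp: compatible_systems_def)
  with sub compat have match: "As + Bs * K = Am" "Bs * L = Bm"
    "(As + A) + (Bs + B) * K = Am" "(Bs + B) * L = Bm"
    unfolding matching_systems_def by blast+
  have "(As + Bs * K) + (A + B * K) = As + Bs * K"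
    using match dist[OF one_carrier_mat K] As Bs A B by simp
  then show "A + B * K = 0\<^sub>m n n" by (rule cancel) (use As Bs A B K in auto)
  have "Bs * L + B * L = Bs * L"
    using match add_mult_distrib_mat[OF Bs B L] by simp
  then show "B * L = 0\<^sub>m n p" by (rule cancel) (use Bs B L in auto)
qed

theorem theorem1:
  fixes n m p T :: nat
    and Am Bm As Bs U X :: "real mat"
  assumes "0 < n" and "0 < m" and "0 < p" and "0 < T"
    and "p \<le> m"
    and "Am \<in> carrier_mat n n" and "schur_stable Am"
    and "Bm \<in> carrier_mat n p"
    and "As \<in> carrier_mat n n" and "Bs \<in> carrier_mat n m"
    and "X \<in> carrier_mat n (T + 1)" and "U \<in> carrier_mat m T"
    and "X_plus X = As * X_minus X + Bs * U"
  shows "(informative_MRC n m p Am Bm U X \<longleftrightarrow>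
            (\<exists>V1 \<in> carrier_mat T n. \<exists>V2 \<in> carrier_mat T p.
               X_minus X * V1 = 1\<^sub>m n \<and> X_plus X * V1 = Am \<and>
               X_minus X * V2 = 0\<^sub>m n p \<and> X_plus X * V2 = Bm))
       \<and> (\<forall>V1 \<in> carrier_mat T n. \<forall>V2 \<in> carrier_mat T p.
            X_minus X * V1 = 1\<^sub>m n \<and> X_plus X * V1 = Am \<and>
            X_minus X * V2 = 0\<^sub>m n p \<and> X_plus X * V2 = Bm \<longrightarrow>
            compatible_systems n m U X \<subseteq> matching_systems n m Am Bm (U * V1) (U * V2))"
proof -
  note Xm = X_minus_carrier[OF assms(11)]
  note X = assms(11) and U = assms(12)
  let ?sol = "\<lambda>V1 V2. X_minus X * V1 = 1\<^sub>m n \<and> X_plus X * V1 = Am \<and>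
    X_minus X * V2 = 0\<^sub>m n p \<and> X_plus X * V2 = Bm"
  have suff: "compatible_systems n m U X \<subseteq> matching_systems n m Am Bm (U * V1) (U * V2)"
    if V1: "V1 \<in> carrier_mat T n" and V2: "V2 \<in> carrier_mat T p" and sol: "?sol V1 V2" for V1 V2
  proof clarify
    fix A B assume "(A, B) \<in> compatible_systems n m U X"
    then have A: "A \<in> carrier_mat n n" and B: "B \<in> carrier_mat n m"
      and sys: "X_plus X = A * X_minus X + B * U"
      by (auto simp: compatible_systems_def)
    \<comment> \<open>Multiplying the data equation of an arbitrary compatible system by
      \<open>V1\<close> and \<open>V2\<close> produces its matching equations.\<close>
    have "Am = A * 1\<^sub>m n + B * (U * V1)" "Bm = A * 0\<^sub>m n p + B * (U * V2)"
      using X_plus_mult[OF A B X U V1 sys] X_plus_mult[OF A B X U V2 sys] sol by argo+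
    then show "(A, B) \<in> matching_systems n m Am Bm (U * V1) (U * V2)"
      using A B mult_carrier_mat[OF B mult_carrier_mat[OF U V2]]
      by (simp add: matching_systems_def)
  qed
  have nec: "\<exists>V1 \<in> carrier_mat T n. \<exists>V2 \<in> carrier_mat T p. ?sol V1 V2"
    if "informative_MRC n m p Am Bm U X"
  proof -
    obtain K L where K: "K \<in> carrier_mat m n" and L: "L \<in> carrier_mat m p"
      and sub: "compatible_systems n m U X \<subseteq> matching_systems n m Am Bm K L"
      using \<open>informative_MRC n m p Am Bm U X\<close> by (auto simp: informative_MRC_def)
    have compat: "(As, Bs) \<in> compatible_systems n m U X"
      using assms by (simp add: compatible_systems_def)
    then have match: "As + Bs * K = Am" "Bs * L = Bm"
      using sub unfolding matching_systems_def by blast+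
    note ker = informative_MRC_imp_left_kernel[OF compat sub X U K L]
    \<comment> \<open>The kernel condition is used for the stacked right-hand side
      \<open>[I; K]\<close>, and below for \<open>[0; L]\<close>, with \<open>k = n\<close>. The
      given gains thus have the form \<open>U * V1\<close> and \<open>U * V2\<close>.\<close>
    have "\<exists>V1 \<in> carrier_mat T n. X_minus X * V1 = 1\<^sub>m n \<and> U * V1 = K"
      by (rule stacked_mult_mat_solvable_if_left_kernel[OF assms(1) Xm U one_carrier_mat K])
        (simp add: ker(1))
    then obtain V1 where V1: "V1 \<in> carrier_mat T n" "X_minus X * V1 = 1\<^sub>m n" "U * V1 = K"
      by blast
    have "\<exists>V2 \<in> carrier_mat T p. X_minus X * V2 = 0\<^sub>m n p \<and> U * V2 = L"
      by (rule stacked_mult_mat_solvable_if_left_kernel[OF assms(1) Xm U zero_carrier_mat L])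
        (simp add: ker(2))
    then obtain V2 where V2: "V2 \<in> carrier_mat T p" "X_minus X * V2 = 0\<^sub>m n p" "U * V2 = L"
      by blast
    \<comment> \<open>The true system turns \<open>X_plus X * V1\<close> into
      \<open>As + Bs * K\<close>, and \<open>X_plus X * V2\<close> into \<open>Bs * L\<close>; both
      are known because the true system itself is compatible and hence matched.\<close>
    have "X_plus X * V1 = Am"
      unfolding X_plus_mult[OF assms(9,10) X U V1(1) assms(13)] V1(2,3)
      using match assms(9) by simp
    moreover have "X_plus X * V2 = Bm"
      unfolding X_plus_mult[OF assms(9,10) X U V2(1) assms(13)] V2(2,3)
      using match assms(8,9) by simp
    ultimately show ?thesis using V1(1,2) V2(1,2) by blast
  qed
  have "informative_MRC n m p Am Bm U X"
    if V1: "V1 \<in> carrier_mat T n" and V2: "V2 \<in> carrier_mat T p" and sol: "?sol V1 V2" for V1 V2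
    unfolding informative_MRC_def
    using suff[OF that] mult_carrier_mat[OF U V1] mult_carrier_mat[OF U V2] by blast
  with nec suff show ?thesis by blast
qed

end
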